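(* Let $n,d\ge1$ be integers, $\lambda\in(0,1)$, $K_n\in[n]$, $K_d\in[d]$, and let $D\le nd$ be a positive integer. Assume that for some $\bar c\ge 10$, $$\max\left\{\lambda\sqrt{\min(D,K_n,K_d)},\ \lambda\frac{K_d}{\sqrt d},\ \lambda\frac{K_n}{\sqrt n},\ \lambda\frac{K_nK_d}{\sqrt{nd}}\right\}\le 2^{-2-\bar c}.$$ Then $$\mathrm{Adv}_{\le D}^2\le 1+2^{-\bar c},$$ and consequently $$\inf_{f\in\mathcal P_{\le D}}\ \sup_{M\in\mathcal H(\lambda,K_n,K_d)\cup\{M_0\}}\mathbb E_M[(f-x_0)^2]\ \ge\ \frac14\left[1-2^{-\bar c}\right].$$
   Context: For $M\in[0,1]^{n\times d}$, $\mathbb E_M$ denotes expectation under the law where $Y\in\{-1,1\}^{n\times d}$ has independent entries with $\mathbb P_M[Y_{i,k}=1]=(1+M_{i,k})/2$. $M_0$ is the zero $n\times d$ matrix and $x_0=x_0(M)=\mathbf 1\{M\ne M_0\}$. $\mathcal H(\lambda,K_n,K_d)$ is the set of matrices $\lambda\mathbf 1\{S\times T\}$ (entry $\lambda$ on $S\times T$, zero elsewhere) with $S\subset[n]$, $|S|=K_n$, $T\subset[d]$, $|T|=K_d$. $\mu$ is the uniform distribution on $\mathcal H(\lambda,K_n,K_d)$, and $\mathbb E_{M\sim\mu}$ denotes expectation for $Y$ when $M\sim\mu$ and then $Y\sim\mathbb P_M$. $\mathcal P_{\le D}$ is the set of real polynomials of degree at most $D$ in the entries of $Y$; $f$ stands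 for $f(Y)$. Define $\mathrm{Adv}(f)=\mathbb E_{M\sim\mu}[f]/(\mathbb E_{M_0}[f^2])^{1/2}$ (convention $0/0=1$) and $\mathrm{Adv}_{\le D}=\sup_{f\in\mathcal P_{\le D}}\mathrm{Adv}(f)$. *)

theory Defs
  imports "HOL-Probability.Probability"
begin

text \<open>
  An \<open>n \<times> d\<close> matrix is a function on index pairs of which only the entries in
  \<open>{1..n} \<times> {1..d}\<close> matter. All matrices \<open>M\<close> and all samples \<open>Y\<close> below vanish outside this
  index set, so equality of functions is equality of matrices.
\<close>

type_synonym rmatrix = "nat \<times> nat \<Rightarrow> real"

definition idx :: "nat \<Rightarrow> nat \<Rightarrow> (nat \<times> nat) set" where
  "idx n d = {1..n} \<times> {1..d}"

definition M0 :: rmatrix where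
  "M0 = (\<lambda>_. 0)"

definition x0 :: "rmatrix \<Rightarrow> real" where
  "x0 M = of_bool (M \<noteq> M0)"

definition sign_pmf :: "real \<Rightarrow> real pmf" where
  "sign_pmf m = map_pmf (\<lambda>b. if b then 1 else -1) (bernoulli_pmf ((1 + m) / 2))"

definition obs_pmf :: "nat \<Rightarrow> nat \<Rightarrow> rmatrix \<Rightarrow> rmatrix pmf" where
  "obs_pmf n d M = Pi_pmf (idx n d) 0 (\<lambda>ik. sign_pmf (M ik))"

definition EM :: "nat \<Rightarrow> nat \<Rightarrow> rmatrix \<Rightarrow> (rmatrix \<Rightarrow> real) \<Rightarrow> real" where
  "EM n d M g = measure_pmf.expectation (obs_pmf n d M) g"

definition planted :: "nat \<Rightarrow> nat \<Rightarrow> real \<Rightarrow> nat \<Rightarrow> nat \<Rightarrow> rmatrix set" where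
  "planted n d l Kn Kd =
     {M. \<exists>S T. S \<subseteq> {1..n} \<and> card S = Kn \<and> T \<subseteq> {1..d} \<and> card T = Kd \<and>
             M = (\<lambda>ik. l * indicator (S \<times> T) ik)}"

definition Emu :: "nat \<Rightarrow> nat \<Rightarrow> real \<Rightarrow> nat \<Rightarrow> nat \<Rightarrow> (rmatrix \<Rightarrow> real) \<Rightarrow> real" where
  "Emu n d l Kn Kd g =
     measure_pmf.expectation (bind_pmf (pmf_of_set (planted n d l Kn Kd)) (obs_pmf n d)) g"

text \<open>
  Polynomials are represented by their evaluation functions: \<open>A\<close> is the finite set of exponent
  vectors, \<open>c\<close> gives the coefficients.
\<close>

definition polys_le :: "nat \<Rightarrow> nat \<Rightarrow> nat \<Rightarrow> (rmatrix \<Rightarrow> real) set" where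
  "polys_le n d D =
     {f. \<exists>(A :: (nat \<times> nat \<Rightarrow> nat) set) (c :: (nat \<times> nat \<Rightarrow> nat) \<Rightarrow> real).
           finite A \<and> (\<forall>\<alpha>\<in>A. (\<Sum>ik\<in>idx n d. \<alpha> ik) \<le> D) \<and>
           f = (\<lambda>Y. \<Sum>\<alpha>\<in>A. c \<alpha> * (\<Prod>ik\<in>idx n d. Y ik ^ \<alpha> ik))}"

text \<open>
  The first branch is the convention \<open>0/0 = 1\<close>. A nonzero numerator over a zero denominator does
  not occur for \<open>l \<in> (0,1)\<close>: \<open>EM n d M0 (\<lambda>Y. (f Y)\<^sup>2) = 0\<close> forces \<open>f\<close> to vanish on all sign matrices.
\<close>

definition Adv :: "nat \<Rightarrow> nat \<Rightarrow> real \<Rightarrow> nat \<Rightarrow> nat \<Rightarrow> (rmatrix \<Rightarrow> real) \<Rightarrow> real" where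
  "Adv n d l Kn Kd f =
     (if Emu n d l Kn Kd f = 0 \<and> EM n d M0 (\<lambda>Y. (f Y)\<^sup>2) = 0 then 1
      else Emu n d l Kn Kd f / sqrt (EM n d M0 (\<lambda>Y. (f Y)\<^sup>2)))"

text \<open>Taken in the extended reals, so that the supremum is meaningful without a boundedness proof.\<close>

definition Adv_le :: "nat \<Rightarrow> nat \<Rightarrow> real \<Rightarrow> nat \<Rightarrow> nat \<Rightarrow> nat \<Rightarrow> ereal" where
  "Adv_le n d l Kn Kd D = (SUP f \<in> polys_le n d D. ereal (Adv n d l Kn Kd f))"

end

theory Submission
  imports Defs
begin

text \<open>
  Write \<open>\<epsilon> = 2 powr (- 2 - c)\<close>, so that the signal bounds say that certain quantities are at most
  \<open>\<epsilon>\<close>, while the claimed excess \<open>2 powr (- c)\<close> is \<open>4 * \<epsilon>\<close>. All estimates below lose only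
  constant factors in front of \<open>\<epsilon>\<^sup>2\<close>, and \<open>\<epsilon> \<le> 2\<^sup>-\<^sup>1\<^sup>2\<close> absorbs them.

  \<^item> On sign matrices a polynomial of degree at most \<open>D\<close> is a combination of the characters
    \<open>\<Prod>ik\<in>G. Y ik\<close> with \<open>card G \<le> D\<close>. These are orthonormal under pure noise, so by
    Cauchy-Schwarz the squared advantage is at most the sum of the squares of their planted means
    (\<open>Emu_square_le\<close>).

  \<^item> The planted mean of the character of \<open>G\<close> is \<open>l ^ card G\<close> times the probability that the
    random rectangle \<open>S \<times> T\<close> contains \<open>G\<close>. Its square is a probability about two independent
    rectangles. Exchanging sums, the quantity to bound is the average over two independent
    rectangles of the sum of \<open>l ^ (2 * card G)\<close> over the sets \<open>G\<close> of at most \<open>D\<close> common cells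
    (\<open>low_degree_norm_replicas\<close>). If \<open>a\<close> rows and \<open>b\<close> columns are shared, this sum is at most
    \<open>1 + (\<Sum>k=1..D. (l\<^sup>2 * a * b) ^ k / fact k)\<close>.

  \<^item> The overlaps \<open>a\<close> and \<open>b\<close> are independent and hypergeometric. The \<open>k\<close>-th moment of \<open>a\<close> is
    at most \<open>(exp 2 * X) ^ k\<close> with \<open>X = min Kn (max k (Kn\<^sup>2 / n))\<close>: the moment is governed by the
    mean or by \<open>k\<close>, whichever is larger, and never exceeds the trivial bound
    (\<open>overlap_moment_le\<close>). The same holds for \<open>b\<close>, with a scale \<open>Y\<close>.

  \<^item> Since \<open>k ^ k \<le> fact k * exp k\<close>, the \<open>k\<close>-th term averages to at most
    \<open>(exp 5 * l\<^sup>2 * X * Y / k) ^ k\<close>. For \<open>1 \<le> k \<le> D\<close> each of the four cases for the two maxima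
    matches one of the four signal bounds and gives \<open>l\<^sup>2 * X * Y / k \<le> \<epsilon>\<^sup>2\<close>
    (\<open>scale_product_le\<close>). What remains is a geometric series of ratio \<open>exp 5 * \<epsilon>\<^sup>2\<close>.

  The risk bound follows from the advantage bound: if the noise risk \<open>E[f\<^sup>2]\<close> is below
  \<open>(1 - \<delta>) / 4\<close> with \<open>\<delta> = 4 * \<epsilon>\<close>, then the planted mean of \<open>f\<close> is at most \<open>1 / 2\<close>, so \<open>f\<close>
  misses the target value \<open>1\<close> by at least \<open>1 / 2\<close> in mean, and some planted matrix has risk at
  least \<open>1 / 4\<close> (\<open>testing_risk_ge\<close>).
\<close>

section \<open>Overlap of two random sets of fixed size\<close>

definition ksubsets :: "'a set \<Rightarrow> nat \<Rightarrow> 'a set set" where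
  "ksubsets A k = {S. S \<subseteq> A \<and> card S = k}"

lemma finite_ksubsets [simp]: "finite A \<Longrightarrow> finite (ksubsets A k)"
  unfolding ksubsets_def by simp

lemma card_ksubsets: "finite A \<Longrightarrow> card (ksubsets A k) = card A choose k"
  unfolding ksubsets_def by (rule n_subsets)

lemma card_ksubsets_superset:
  assumes "finite A" "J \<subseteq> A" "card J \<le> k"
  shows "card {S \<in> ksubsets A k. J \<subseteq> S} = (card A - card J) choose (k - card J)"
proof -
  have fJ: "finite J" using assms finite_subset by blast
  have "bij_betw (\<lambda>U. U \<union> J) (ksubsets (A - J) (k - card J)) {S \<in> ksubsets A k. J \<subseteq> S}"
  proof (rule bij_betwI[where g = "\<lambda>S. S - J"])
    show "(\<lambda>U. U \<union> J) \<in> ksubsets (A - J) (k - card J) \<rightarrow> {S \<in> ksubsets A k. J \<subseteq> S}"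
    proof
      fix U assume U: "U \<in> ksubsets (A - J) (k - card J)"
      then have "finite U" "U \<inter> J = {}"
        using assms(1) by (auto simp: ksubsets_def intro: finite_subset)
      then have "card (U \<union> J) = k"
        using U fJ assms(3) by (simp add: card_Un_disjoint ksubsets_def)
      then show "U \<union> J \<in> {S \<in> ksubsets A k. J \<subseteq> S}"
        using U assms(2) by (auto simp: ksubsets_def)
    qed
    show "(\<lambda>S. S - J) \<in> {S \<in> ksubsets A k. J \<subseteq> S} \<rightarrow> ksubsets (A - J) (k - card J)"
      using fJ by (auto simp: ksubsets_def card_Diff_subset)
  qed (auto simp: ksubsets_def)
  then show ?thesis
    using bij_betw_same_card card_ksubsets[of "A - J" "k - card J"] assms(1,2) fJ
    by (metis card_Diff_subset finite_Diff)
qed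

text \<open>
  The probability that a random \<open>k\<close>-subset of \<open>n\<close> points contains \<open>j\<close> given points is a product
  of factors \<open>(k - i) / (n - i)\<close>, each at most \<open>k / n\<close>. The induction removes one factor at a
  time, and clearing denominators keeps everything in the natural numbers.
\<close>

lemma binomial_diff_le_power_ratio:
  assumes "j \<le> k" "k \<le> n"
  shows "(n - j choose (k - j)) * n ^ j \<le> (n choose k) * k ^ j"
  using assms(1)
proof (induction j)
  case (Suc j)
  let ?B = "n - j choose (k - j)" and ?B' = "n - Suc j choose (k - Suc j)"
  have absorb: "(n - j) * ?B' = (k - j) * ?B"
    using times_binomial_minus1_eq[of "k - j" "n - j"] Suc.prems by simp
  \<comment> \<open>This is \<open>(k - j) / (n - j) \<le> k / n\<close>.\<close>
  have "k * n - j * n \<le> k * n - j * k"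
    using assms(2) by (intro diff_le_mono2) simp
  then have cross: "n * (k - j) \<le> k * (n - j)"
    by (simp add: diff_mult_distrib2 mult.commute)
  have IH: "n ^ j * ?B \<le> (n choose k) * k ^ j"
    using Suc by (simp add: mult.commute)
  have "(n - j) * (?B' * n ^ Suc j) = n ^ j * ?B * (n * (k - j))"
    using absorb by (metis (no_types, lifting) mult.commute mult.left_commute power_Suc)
  also have "\<dots> \<le> ((n choose k) * k ^ j) * (k * (n - j))"
    by (rule mult_le_mono[OF IH cross])
  also have "\<dots> = (n - j) * ((n choose k) * k ^ Suc j)"
    by (simp add: algebra_simps)
  finally show ?case using Suc.prems assms(2) by simp
qed simp

lemma ksubsets_inclusion_prob_le:
  assumes "finite A" "J \<subseteq> A" "card J \<le> k" "k \<le> card A" "0 < k"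
  shows "real (card {S \<in> ksubsets A k. J \<subseteq> S})
           \<le> (real k / real (card A)) ^ card J * real (card (ksubsets A k))"
proof -
  have "real ((card A - card J choose (k - card J)) * card A ^ card J)
          \<le> real ((card A choose k) * k ^ card J)"
    using binomial_diff_le_power_ratio[of "card J" k "card A"] assms by (simp only: of_nat_le_iff)
  then show ?thesis
    using assms by (simp add: card_ksubsets_superset card_ksubsets field_simps)
qed

lemma sum_Pow_power_card:
  "finite A \<Longrightarrow> (\<Sum>J\<in>Pow A. t ^ card J) = (1 + t :: real) ^ card A"
  using prod_add[of A "\<lambda>_. t" "\<lambda>_. 1"] by (simp add: add.commute)

text \<open>
  Drawing without replacement is dominated by independent draws: expanding \<open>(1 + t) ^ card (S \<inter> S')\<close>
  over the subsets of \<open>S \<inter> S'\<close> reduces the claim to inclusion probabilities, and replacing each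
  by \<open>(k / card A) ^ card J\<close> leaves the generating function of a binomial distribution.
\<close>

lemma overlap_pgf_le:
  assumes A: "finite A" "S' \<in> ksubsets A k" "k \<le> card A" "0 < k" and t: "0 \<le> t"
  shows "(\<Sum>S\<in>ksubsets A k. (1 + t) ^ card (S \<inter> S'))
           \<le> (1 + t * real k / real (card A)) ^ k * real (card (ksubsets A k))"
proof -
  have S': "S' \<subseteq> A" "card S' = k" "finite S'"
    using A finite_subset by (auto simp: ksubsets_def)
  have "(\<Sum>S\<in>ksubsets A k. (1 + t) ^ card (S \<inter> S'))
      = (\<Sum>S\<in>ksubsets A k. \<Sum>J\<in>Pow S'. if J \<subseteq> S then t ^ card J else 0)"
  proof (rule sum.cong[OF refl])
    fix S
    have "(1 + t) ^ card (S \<inter> S') = (\<Sum>J\<in>Pow (S \<inter> S'). t ^ card J)"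
      using S' by (intro sum_Pow_power_card[symmetric]) simp
    also have "\<dots> = (\<Sum>J\<in>Pow S'. if J \<subseteq> S then t ^ card J else 0)"
      using S' by (intro sum.mono_neutral_cong_left) auto
    finally show "(1 + t) ^ card (S \<inter> S') = \<dots>" .
  qed
  also have "\<dots> = (\<Sum>J\<in>Pow S'. real (card {S \<in> ksubsets A k. J \<subseteq> S}) * t ^ card J)"
    using A by (subst sum.swap) (simp flip: sum.inter_filter)
  also have "\<dots> \<le> (\<Sum>J\<in>Pow S'. ((real k / real (card A)) ^ card J
                     * real (card (ksubsets A k))) * t ^ card J)"
  proof (intro sum_mono mult_right_mono)
    fix J assume J: "J \<in> Pow S'"
    then have "card J \<le> k" using S' card_mono by blast
    with J S' A show "real (card {S \<in> ksubsets A k. J \<subseteq> S})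
           \<le> (real k / real (card A)) ^ card J * real (card (ksubsets A k))"
      by (intro ksubsets_inclusion_prob_le) auto
  qed (use t in auto)
  also have "\<dots> = (\<Sum>J\<in>Pow S'. (t * real k / real (card A)) ^ card J) * real (card (ksubsets A k))"
    unfolding sum_distrib_right by (intro sum.cong refl) (simp add: power_divide power_mult_distrib)
  also have "(\<Sum>J\<in>Pow S'. (t * real k / real (card A)) ^ card J)
               = (1 + t * real k / real (card A)) ^ k"
    using S' by (simp add: sum_Pow_power_card)
  finally show ?thesis .
qed

lemma overlap_mgf_le:
  assumes A: "finite A" "S' \<in> ksubsets A k" "k \<le> card A" "0 < k" and s: "0 \<le> s" "s \<le> 1"
  shows "(\<Sum>S\<in>ksubsets A k. exp (s * real (card (S \<inter> S'))))
           \<le> exp (2 * s * (real k)\<^sup>2 / real (card A)) * real (card (ksubsets A k))"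
proof -
  \<comment> \<open>On \<open>[0, 1]\<close> the exponential is close enough to linear: \<open>t \<le> 2 * s\<close>.\<close>
  define t where "t = exp s - 1"
  have "s\<^sup>2 \<le> s" using s by (simp add: power2_eq_square mult_left_le)
  then have t: "0 \<le> t" "t \<le> 2 * s"
    using s exp_bound[of s] by (auto simp: t_def)
  have "(\<Sum>S\<in>ksubsets A k. exp (s * real (card (S \<inter> S'))))
          = (\<Sum>S\<in>ksubsets A k. (1 + t) ^ card (S \<inter> S'))"
    by (simp add: t_def exp_of_nat2_mult)
  also have "\<dots> \<le> (1 + t * real k / real (card A)) ^ k * real (card (ksubsets A k))"
    by (rule overlap_pgf_le[OF A t(1)])
  also have "\<dots> \<le> exp (2 * s * real k / real (card A)) ^ k * real (card (ksubsets A k))"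
  proof (intro mult_right_mono power_mono)
    have "1 + t * real k / real (card A) \<le> 1 + 2 * s * real k / real (card A)"
      using t by (intro add_left_mono divide_right_mono mult_right_mono) auto
    also have "\<dots> \<le> exp (2 * s * real k / real (card A))"
      by (rule exp_ge_add_one_self)
    finally show "1 + t * real k / real (card A) \<le> exp (2 * s * real k / real (card A))" .
  qed (use t in auto)
  also have "exp (2 * s * real k / real (card A)) ^ k = exp (2 * s * (real k)\<^sup>2 / real (card A))"
    by (simp flip: exp_of_nat_mult add: power2_eq_square mult_ac)
  finally show ?thesis .
qed

text \<open>
  A single term of the exponential series is at most its sum. With \<open>x = k\<close> this is the lower
  Stirling bound on the factorial.
\<close>

lemma power_le_fact_mult_exp:
  fixes x :: real
  assumes "0 \<le> x"
  shows "x ^ k \<le> fact k * exp x"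
proof -
  have "(\<Sum>n\<in>{k}. x ^ n /\<^sub>R fact n) \<le> (\<Sum>n. x ^ n /\<^sub>R fact n)"
    using assms by (intro sum_le_suminf summable_exp_generic) auto
  then show ?thesis
    by (simp add: exp_def field_simps)
qed

text \<open>
  The size of the overlap of two random \<open>K\<close>-subsets of \<open>N\<close> points as seen by the \<open>k\<close>-th moment:
  the mean \<open>K\<^sup>2 / N\<close> once it exceeds \<open>k\<close>, otherwise \<open>k\<close> itself, but never more than the largest
  possible overlap \<open>K\<close>.
\<close>

definition overlap_scale :: "nat \<Rightarrow> nat \<Rightarrow> nat \<Rightarrow> real" where
  "overlap_scale N K k = min (real K) (max (real k) ((real K)\<^sup>2 / real N))"

lemma overlap_scale_nonneg: "0 \<le> overlap_scale N K k"
  by (simp add: overlap_scale_def)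

text \<open>
  If the cap \<open>K\<close> is the smaller bound, the estimate holds pointwise. Otherwise
  \<open>(s * a) ^ k \<le> fact k * exp (s * a)\<close> turns the exponential moment into a power moment. The choice
  \<open>s = k / m\<close>, with \<open>m\<close> the larger of \<open>k\<close> and the mean, is the largest rate at most \<open>1\<close> for which
  the bound on the moment generating function does not exceed \<open>exp (2 * k)\<close>.
\<close>

lemma overlap_moment_le_one:
  assumes A: "finite A" "S' \<in> ksubsets A K" "K \<le> card A" "0 < K" and k: "0 < k"
  shows "(\<Sum>S\<in>ksubsets A K. real (card (S \<inter> S')) ^ k)
           \<le> (exp 2 * overlap_scale (card A) K k) ^ k * real (card (ksubsets A K))"
proof -
  define m where "m = max (real k) ((real K)\<^sup>2 / real (card A))"
  define s where "s = real k / m"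
  have m: "0 < m" "real k \<le> m" "(real K)\<^sup>2 / real (card A) \<le> m"
    using k by (auto simp: m_def)
  have s: "0 < s" "s \<le> 1" "s * m = real k"
    using m k by (auto simp: s_def)
  show ?thesis
  proof (cases "real K \<le> m")
    case True
    have "(\<Sum>S\<in>ksubsets A K. real (card (S \<inter> S')) ^ k)
            \<le> real (card (ksubsets A K)) * (exp 2 * real K) ^ k"
    proof (rule sum_bounded_above)
      fix S
      have "real (card (S \<inter> S')) \<le> real K"
        using A by (metis (mono_tags, lifting) card_mono finite_subset inf_le2 ksubsets_def
            mem_Collect_eq of_nat_le_iff)
      also have "\<dots> \<le> exp 2 * real K"
        by (simp add: mult_le_cancel_right1)
      finally show "real (card (S \<inter> S')) ^ k \<le> (exp 2 * real K) ^ k"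
        by (rule power_mono) simp
    qed
    then show ?thesis using True by (simp add: overlap_scale_def m_def mult.commute)
  next
    case False
    have pt: "real a ^ k \<le> m ^ k * exp (s * real a)" for a
    proof -
      have "s ^ k * real a ^ k \<le> fact k * exp (s * real a)"
        using power_le_fact_mult_exp[of "s * real a" k] s by (simp add: power_mult_distrib)
      also have "\<dots> \<le> real k ^ k * exp (s * real a)"
        using fact_le_power[of k, where 'a = real] by (intro mult_right_mono) auto
      also have "real k ^ k = s ^ k * m ^ k"
        by (simp flip: s(3) power_mult_distrib)
      finally show ?thesis using s(1) by simp
    qed
    have "(\<Sum>S\<in>ksubsets A K. real (card (S \<inter> S')) ^ k)
            \<le> m ^ k * (\<Sum>S\<in>ksubsets A K. exp (s * real (card (S \<inter> S'))))"
      unfolding sum_distrib_left by (intro sum_mono pt)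
    also have "\<dots> \<le> m ^ k * (exp (2 * s * (real K)\<^sup>2 / real (card A)) * real (card (ksubsets A K)))"
      using m s by (intro mult_left_mono overlap_mgf_le A) auto
    also have "\<dots> \<le> m ^ k * (exp (real k * 2) * real (card (ksubsets A K)))"
    proof -
      have "s * ((real K)\<^sup>2 / real (card A)) \<le> s * m"
        using s m by (intro mult_left_mono) auto
      then show ?thesis
        using m s by (intro mult_left_mono mult_right_mono) auto
    qed
    also have "\<dots> = (exp 2 * m) ^ k * real (card (ksubsets A K))"
      by (simp add: exp_of_nat_mult power_mult_distrib)
    finally show ?thesis using False by (simp add: overlap_scale_def m_def)
  qed
qed

lemma overlap_moment_le:
  assumes "finite A" "K \<le> card A" "0 < K" "0 < k"
  shows "(\<Sum>S'\<in>ksubsets A K. \<Sum>S\<in>ksubsets A K. real (card (S \<inter> S')) ^ k)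
           \<le> (exp 2 * overlap_scale (card A) K k) ^ k * (real (card (ksubsets A K)))\<^sup>2"
proof -
  have "(\<Sum>S'\<in>ksubsets A K. \<Sum>S\<in>ksubsets A K. real (card (S \<inter> S')) ^ k)
    \<le> real (card (ksubsets A K)) * ((exp 2 * overlap_scale (card A) K k) ^ k * real (card (ksubsets A K)))"
    by (intro sum_bounded_above overlap_moment_le_one assms)
  then show ?thesis by (simp add: power2_eq_square mult_ac)
qed

text \<open>
  Each of the four ways in which the row mean and the column mean can compare with \<open>k\<close> uses one of
  the four bounds. When both means are at most \<open>k\<close>, the product of the scales is
  \<open>min Kn k * min Kd k\<close>: one factor is at most \<open>min Kn Kd\<close>, and both are at most \<open>k \<le> D\<close>. This
  is where the degree bound enters.
\<close>

lemma scale_product_le: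
  fixes l e :: real
  assumes k: "0 < k" "k \<le> D"
    and "l\<^sup>2 * real (min D (min Kn Kd)) \<le> e"
    and "l\<^sup>2 * ((real Kd)\<^sup>2 / real d) \<le> e"
    and "l\<^sup>2 * ((real Kn)\<^sup>2 / real n) \<le> e"
    and "l\<^sup>2 * ((real Kn)\<^sup>2 / real n * ((real Kd)\<^sup>2 / real d)) \<le> e"
  shows "l\<^sup>2 * (overlap_scale n Kn k * overlap_scale d Kd k) \<le> real k * e"
proof -
  let ?a = "(real Kn)\<^sup>2 / real n" and ?b = "(real Kd)\<^sup>2 / real d"
  let ?X = "overlap_scale n Kn k" and ?Y = "overlap_scale d Kd k"
  have nn: "0 \<le> ?X" "0 \<le> ?Y" by (rule overlap_scale_nonneg)+
  have e: "0 \<le> e" using assms(3) by (meson of_nat_0_le_iff order_trans zero_le_mult_iff zero_le_power2)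
  have k1: "1 \<le> real k" using k by simp
  consider "?a \<le> k" "?b \<le> k" | "k < ?a" "?b \<le> k" | "?a \<le> k" "k < ?b" | "k < ?a" "k < ?b"
    by linarith
  then show ?thesis
  proof cases
    case 1
    have "?X * ?Y \<le> real k * real (min D (min Kn Kd))"
    proof -
      have "?X = real (min Kn k)" "?Y = real (min Kd k)"
        using 1 by (auto simp: overlap_scale_def max_def)
      moreover have "min Kn k * min Kd k \<le> k * min D (min Kn Kd)"
      proof (cases "Kn \<le> Kd")
        case True
        then have "min Kn k \<le> min D (min Kn Kd)" using k by auto
        then have "min Kn k * min Kd k \<le> min D (min Kn Kd) * k" by (intro mult_le_mono) auto
        then show ?thesis by (simp add: mult.commute)
      next
        case False
        then have "min Kd k \<le> min D (min Kn Kd)" using k by auto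
        then show ?thesis by (metis min.cobounded2 mult_le_mono)
      qed
      ultimately show ?thesis by (metis of_nat_le_iff of_nat_mult)
    qed
    then have "l\<^sup>2 * (?X * ?Y) \<le> l\<^sup>2 * (real k * real (min D (min Kn Kd)))"
      by (rule mult_left_mono) simp
    also have "\<dots> = real k * (l\<^sup>2 * real (min D (min Kn Kd)))" by simp
    also have "\<dots> \<le> real k * e" using assms(3) by (intro mult_left_mono) auto
    finally show ?thesis .
  next
    case 2
    then have "?X * ?Y \<le> ?a * real k"
      by (intro mult_mono nn) (auto simp: overlap_scale_def)
    then have "l\<^sup>2 * (?X * ?Y) \<le> l\<^sup>2 * (?a * real k)"
      by (rule mult_left_mono) simp
    also have "\<dots> = real k * (l\<^sup>2 * ?a)" by simp
    also have "\<dots> \<le> real k * e" using assms(5) by (intro mult_left_mono) auto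
    finally show ?thesis .
  next
    case 3
    then have "?X * ?Y \<le> real k * ?b"
      by (intro mult_mono nn) (auto simp: overlap_scale_def)
    then have "l\<^sup>2 * (?X * ?Y) \<le> l\<^sup>2 * (real k * ?b)"
      by (rule mult_left_mono) simp
    also have "\<dots> = real k * (l\<^sup>2 * ?b)" by simp
    also have "\<dots> \<le> real k * e" using assms(4) by (intro mult_left_mono) auto
    finally show ?thesis .
  next
    case 4
    then have "?X * ?Y \<le> ?a * ?b"
      by (intro mult_mono nn) (auto simp: overlap_scale_def)
    then have "l\<^sup>2 * (?X * ?Y) \<le> l\<^sup>2 * (?a * ?b)"
      by (rule mult_left_mono) simp
    also have "\<dots> \<le> 1 * e" using assms(6) by simp
    also have "\<dots> \<le> real k * e" using e k1 by (intro mult_right_mono) auto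
    finally show ?thesis .
  qed
qed

section \<open>The second moment of the planted means\<close>

lemma geometric_series_le:
  fixes q :: real
  assumes "0 \<le> q" "q \<le> 1 / 2"
  shows "(\<Sum>k=1..D. q ^ k) \<le> 2 * q"
proof -
  have "(\<Sum>k=1..D. q ^ k) = q * (\<Sum>k<D. q ^ k)"
    by (simp add: sum_distrib_left sum.atLeast1_atMost_eq)
  also have "\<dots> \<le> q * 2"
  proof (rule mult_left_mono[OF _ assms(1)])
    have "(\<Sum>k<D. q ^ k) \<le> (\<Sum>k. q ^ k)"
      using assms by (intro sum_le_suminf summable_geometric) auto
    also have "\<dots> = 1 / (1 - q)" using assms by (intro suminf_geometric) auto
    also have "\<dots> \<le> 2" using assms by (simp add: field_simps)
    finally show "(\<Sum>k<D. q ^ k) \<le> 2" .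
  qed
  finally show ?thesis by (simp add: mult.commute)
qed

definition supports :: "nat \<Rightarrow> nat \<Rightarrow> nat \<Rightarrow> nat \<Rightarrow> (nat set \<times> nat set) set" where
  "supports n d Kn Kd = ksubsets {1..n} Kn \<times> ksubsets {1..d} Kd"

definition cells :: "nat set \<times> nat set \<Rightarrow> (nat \<times> nat) set" where
  "cells x = fst x \<times> snd x"

definition low_sets :: "nat \<Rightarrow> nat \<Rightarrow> nat \<Rightarrow> (nat \<times> nat) set set" where
  "low_sets n d D = {G. G \<subseteq> idx n d \<and> card G \<le> D}"

lemma finite_idx [simp]: "finite (idx n d)"
  by (simp add: idx_def)

lemma finite_low_sets [simp]: "finite (low_sets n d D)"
  by (simp add: low_sets_def)

lemma finite_supports [simp]: "finite (supports n d Kn Kd)"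
  by (simp add: supports_def)

lemma cells_subset_idx: "x \<in> supports n d Kn Kd \<Longrightarrow> cells x \<subseteq> idx n d"
  by (auto simp: supports_def cells_def idx_def ksubsets_def)

text \<open>
  Grouping by size, there are \<open>card R choose k\<close> sets of size \<open>k\<close>, which is at most
  \<open>card R ^ k / fact k\<close>. Stopping at \<open>D\<close> is essential: the full sum is \<open>(1 + t) ^ card R\<close>, whose
  average over random overlaps can be enormous.
\<close>

lemma sum_truncated_Pow_le:
  fixes t :: real
  assumes "finite R" "0 \<le> t"
  shows "(\<Sum>G | G \<subseteq> R \<and> card G \<le> D. t ^ card G)
           \<le> 1 + (\<Sum>k=1..D. (t * real (card R)) ^ k / fact k)"
proof -
  have "{G. G \<subseteq> R \<and> card G \<le> D} = (\<Union>k\<in>{..D}. ksubsets R k)"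
    by (auto simp: ksubsets_def)
  then have "(\<Sum>G | G \<subseteq> R \<and> card G \<le> D. t ^ card G) = (\<Sum>k\<le>D. \<Sum>G\<in>ksubsets R k. t ^ card G)"
    using assms by (simp only:) (rule sum.UNION_disjoint, auto simp: ksubsets_def)
  also have "\<dots> = (\<Sum>k\<le>D. real (card R choose k) * t ^ k)"
  proof (rule sum.cong[OF refl])
    fix k
    have "(\<Sum>G\<in>ksubsets R k. t ^ card G) = (\<Sum>G\<in>ksubsets R k. t ^ k)"
      by (rule sum.cong) (auto simp: ksubsets_def)
    then show "(\<Sum>G\<in>ksubsets R k. t ^ card G) = real (card R choose k) * t ^ k"
      using assms by (simp add: card_ksubsets)
  qed
  also have "\<dots> \<le> (\<Sum>k\<le>D. (t * real (card R)) ^ k / fact k)"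
  proof (rule sum_mono)
    fix k
    have "real (card R choose k) * fact k \<le> real (card R) ^ k"
      using binomial_fact_pow[of "card R" k] by (metis of_nat_fact of_nat_le_iff of_nat_mult of_nat_power)
    then have "real (card R choose k) \<le> real (card R) ^ k / fact k"
      by (simp add: field_simps)
    then have "real (card R choose k) * t ^ k \<le> real (card R) ^ k / fact k * t ^ k"
      using assms by (intro mult_right_mono) auto
    then show "real (card R choose k) * t ^ k \<le> (t * real (card R)) ^ k / fact k"
      by (simp add: power_mult_distrib mult_ac)
  qed
  also have "\<dots> = 1 + (\<Sum>k=1..D. (t * real (card R)) ^ k / fact k)"
    by (simp add: atMost_atLeast0 sum.atLeast_Suc_atMost)
  finally show ?thesis .
qed

lemma sum_pairs_mult:
  fixes f g :: "_ \<Rightarrow> _ \<Rightarrow> real"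
  shows "(\<Sum>x\<in>P \<times> Q. \<Sum>y\<in>P \<times> Q. f (fst x) (fst y) * g (snd x) (snd y))
         = (\<Sum>S\<in>P. \<Sum>S'\<in>P. f S S') * (\<Sum>T\<in>Q. \<Sum>T'\<in>Q. g T T')"
proof -
  have factor: "(\<Sum>y\<in>P \<times> Q. a (fst y) * b (snd y)) = (\<Sum>S\<in>P. a S) * (\<Sum>T\<in>Q. b T)"
    for a b :: "_ \<Rightarrow> real"
    by (simp add: sum_product sum.cartesian_product case_prod_unfold)
  show ?thesis
    using factor[of "\<lambda>S. sum (f S) P" "\<lambda>T. sum (g T) Q"] by (simp add: factor)
qed

text \<open>
  Squaring the number of rectangles that contain \<open>G\<close> counts pairs of rectangles that both contain
  \<open>G\<close>. Exchanging the sums leaves, for each pair, the sets of common cells.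
\<close>

lemma low_degree_norm_replicas:
  fixes l :: real
  shows "(\<Sum>G\<in>low_sets n d D. (\<Sum>x\<in>supports n d Kn Kd. if G \<subseteq> cells x then l ^ card G else 0)\<^sup>2)
       = (\<Sum>x\<in>supports n d Kn Kd. \<Sum>y\<in>supports n d Kn Kd.
            \<Sum>G | G \<subseteq> cells x \<inter> cells y \<and> card G \<le> D. (l\<^sup>2) ^ card G)"
proof -
  let ?P = "supports n d Kn Kd"
  have "(\<Sum>G\<in>low_sets n d D. (\<Sum>x\<in>?P. if G \<subseteq> cells x then l ^ card G else 0)\<^sup>2)
      = (\<Sum>G\<in>low_sets n d D. \<Sum>x\<in>?P. \<Sum>y\<in>?P. if G \<subseteq> cells x \<inter> cells y then (l\<^sup>2) ^ card G else 0)"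
    unfolding power2_eq_square sum_product
    by (intro sum.cong refl) (auto simp: power_mult_distrib)
  also have "\<dots> = (\<Sum>x\<in>?P. \<Sum>y\<in>?P. \<Sum>G\<in>low_sets n d D. if G \<subseteq> cells x \<inter> cells y then (l\<^sup>2) ^ card G else 0)"
    by (subst sum.swap, rule sum.cong[OF refl], rule sum.swap)
  also have "\<dots> = (\<Sum>x\<in>?P. \<Sum>y\<in>?P. \<Sum>G | G \<subseteq> cells x \<inter> cells y \<and> card G \<le> D. (l\<^sup>2) ^ card G)"
  proof (rule sum.cong[OF refl], rule sum.cong[OF refl])
    fix x y assume "x \<in> ?P" "y \<in> ?P"
    then have "{G. G \<subseteq> cells x \<inter> cells y \<and> card G \<le> D} = {G \<in> low_sets n d D. G \<subseteq> cells x \<inter> cells y}"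
      using cells_subset_idx[of x n d Kn Kd] unfolding low_sets_def by blast
    then show "(\<Sum>G\<in>low_sets n d D. if G \<subseteq> cells x \<inter> cells y then (l\<^sup>2) ^ card G else 0)
             = (\<Sum>G | G \<subseteq> cells x \<inter> cells y \<and> card G \<le> D. (l\<^sup>2) ^ card G)"
      by (simp only: sum.inter_filter[OF finite_low_sets])
  qed
  finally show ?thesis .
qed

text \<open>
  The common cells of two rectangles form the product of the row overlap and the column overlap, so
  the \<open>k\<close>-th term of the truncated exponential factors into a row moment and a column moment. The
  moment bounds contribute \<open>exp 2\<close> each and the factorial one further \<open>exp 1\<close>, whence \<open>exp 5\<close>.
\<close>

lemma low_degree_norm_le:
  fixes l e :: real
  assumes K: "Kn \<in> {1..n}" "Kd \<in> {1..d}"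
    and "l\<^sup>2 * real (min D (min Kn Kd)) \<le> e"
    and "l\<^sup>2 * ((real Kd)\<^sup>2 / real d) \<le> e"
    and "l\<^sup>2 * ((real Kn)\<^sup>2 / real n) \<le> e"
    and "l\<^sup>2 * ((real Kn)\<^sup>2 / real n * ((real Kd)\<^sup>2 / real d)) \<le> e"
    and small: "exp 5 * e \<le> 1 / 2"
  shows "(\<Sum>G\<in>low_sets n d D. (\<Sum>x\<in>supports n d Kn Kd. if G \<subseteq> cells x then l ^ card G else 0)\<^sup>2)
           \<le> (1 + 2 * (exp 5 * e)) * (real (card (supports n d Kn Kd)))\<^sup>2"
proof -
  let ?P = "supports n d Kn Kd" and ?R = "ksubsets {1..n} Kn" and ?C = "ksubsets {1..d} Kd"
  let ?X = "overlap_scale n Kn" and ?Y = "overlap_scale d Kd"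
  have e: "0 \<le> e" using assms(3) by (meson of_nat_0_le_iff order_trans zero_le_mult_iff zero_le_power2)
  have moments: "(\<Sum>x\<in>?P. \<Sum>y\<in>?P. (l\<^sup>2 * real (card (cells x \<inter> cells y))) ^ k / fact k)
               \<le> (exp 5 * e) ^ k * (real (card ?P))\<^sup>2" if k: "k \<in> {1..D}" for k
  proof -
    define MR where "MR = (\<Sum>S'\<in>?R. \<Sum>S\<in>?R. real (card (S \<inter> S')) ^ k)"
    define MC where "MC = (\<Sum>T'\<in>?C. \<Sum>T\<in>?C. real (card (T \<inter> T')) ^ k)"
    have card_cells: "card (cells x \<inter> cells y) = card (fst y \<inter> fst x) * card (snd y \<inter> snd x)" for x y
      by (simp add: cells_def Times_Int_Times card_cartesian_product Int_commute)
    have nn: "0 \<le> MC" by (auto simp: MC_def intro!: sum_nonneg)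
    have MR: "MR \<le> (exp 2 * ?X k) ^ k * (real (card ?R))\<^sup>2"
      using overlap_moment_le[of "{1..n}" Kn k] K k by (simp add: MR_def)
    have MC: "MC \<le> (exp 2 * ?Y k) ^ k * (real (card ?C))\<^sup>2"
      using overlap_moment_le[of "{1..d}" Kd k] K k by (simp add: MC_def)
    have "(\<Sum>x\<in>?P. \<Sum>y\<in>?P. (l\<^sup>2 * real (card (cells x \<inter> cells y))) ^ k / fact k)
        = (l\<^sup>2) ^ k / fact k * (MR * MC)"
      unfolding MR_def MC_def
      unfolding sum_pairs_mult[of "\<lambda>S' S. real (card (S \<inter> S')) ^ k"
          "\<lambda>T' T. real (card (T \<inter> T')) ^ k" ?R ?C, symmetric]
      unfolding sum_distrib_left
      by (intro sum.cong) (simp_all add: supports_def card_cells power_mult_distrib)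
    also have "\<dots> \<le> (l\<^sup>2) ^ k / fact k * (((exp 2 * ?X k) ^ k * (real (card ?R))\<^sup>2)
                                      * ((exp 2 * ?Y k) ^ k * (real (card ?C))\<^sup>2))"
      by (intro mult_left_mono mult_mono MR MC nn) (auto simp: overlap_scale_nonneg)
    also have "\<dots> = (exp 4 * (l\<^sup>2 * (?X k * ?Y k))) ^ k / fact k * (real (card ?P))\<^sup>2"
    proof -
      have "exp 4 = exp 2 * exp (2::real)" by (simp flip: exp_add)
      then show ?thesis
        by (simp add: supports_def card_cartesian_product power_mult_distrib mult_ac)
    qed
    also have "\<dots> \<le> (exp 5 * e) ^ k * (real (card ?P))\<^sup>2"
    proof (rule mult_right_mono)
      have "l\<^sup>2 * (?X k * ?Y k) \<le> real k * e"
        using k by (intro scale_product_le[of k D] assms) auto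
      then have "(exp 4 * (l\<^sup>2 * (?X k * ?Y k))) ^ k \<le> (exp 4 * (real k * e)) ^ k"
        by (intro power_mono mult_left_mono) (auto simp: overlap_scale_nonneg)
      also have "\<dots> = (exp 4 * e) ^ k * real k ^ k"
        by (simp add: power_mult_distrib mult_ac)
      also have "\<dots> \<le> (exp 4 * e) ^ k * (fact k * exp (real k))"
        using e by (intro mult_left_mono power_le_fact_mult_exp) auto
      also have "\<dots> = (exp 5 * e) ^ k * fact k"
      proof -
        have "exp 5 = exp 4 * exp (1::real)" by (simp flip: exp_add)
        moreover have "exp (real k) = exp 1 ^ k" by (simp flip: exp_of_nat_mult)
        ultimately show ?thesis by (simp add: power_mult_distrib mult_ac)
      qed
      finally show "(exp 4 * (l\<^sup>2 * (?X k * ?Y k))) ^ k / fact k \<le> (exp 5 * e) ^ k"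
        by (simp add: field_simps)
    qed simp
    finally show ?thesis .
  qed
  have "(\<Sum>G\<in>low_sets n d D. (\<Sum>x\<in>?P. if G \<subseteq> cells x then l ^ card G else 0)\<^sup>2)
      \<le> (\<Sum>x\<in>?P. \<Sum>y\<in>?P. 1 + (\<Sum>k=1..D. (l\<^sup>2 * real (card (cells x \<inter> cells y))) ^ k / fact k))"
    unfolding low_degree_norm_replicas
  proof (intro sum_mono sum_truncated_Pow_le)
    show "finite (cells x \<inter> cells y)" if "x \<in> ?P" for x y
      using cells_subset_idx[OF that] finite_idx finite_subset by blast
  qed simp
  also have "\<dots> = (real (card ?P))\<^sup>2
      + (\<Sum>x\<in>?P. \<Sum>y\<in>?P. \<Sum>k=1..D. (l\<^sup>2 * real (card (cells x \<inter> cells y))) ^ k / fact k)"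
    by (simp add: sum.distrib power2_eq_square)
  also have "(\<Sum>x\<in>?P. \<Sum>y\<in>?P. \<Sum>k=1..D. (l\<^sup>2 * real (card (cells x \<inter> cells y))) ^ k / fact k)
      = (\<Sum>x\<in>?P. \<Sum>k=1..D. \<Sum>y\<in>?P. (l\<^sup>2 * real (card (cells x \<inter> cells y))) ^ k / fact k)"
    by (rule sum.cong[OF refl], rule sum.swap)
  also have "\<dots> = (\<Sum>k=1..D. \<Sum>x\<in>?P. \<Sum>y\<in>?P. (l\<^sup>2 * real (card (cells x \<inter> cells y))) ^ k / fact k)"
    by (rule sum.swap)
  also have "\<dots> \<le> (\<Sum>k=1..D. (exp 5 * e) ^ k * (real (card ?P))\<^sup>2)"
    by (rule sum_mono) (rule moments)
  also have "\<dots> = (\<Sum>k=1..D. (exp 5 * e) ^ k) * (real (card ?P))\<^sup>2"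
    by (rule sum_distrib_right[symmetric])
  also have "\<dots> \<le> 2 * (exp 5 * e) * (real (card ?P))\<^sup>2"
    using e small by (intro mult_right_mono geometric_series_le) auto
  finally show ?thesis by (simp add: algebra_simps)
qed

section \<open>Characters of sign matrices\<close>

lemma expectation_sign_pmf:
  assumes "\<bar>m\<bar> \<le> 1"
  shows "measure_pmf.expectation (sign_pmf m) (\<lambda>y. y) = m"
  using assms by (simp add: sign_pmf_def field_simps)

lemma finite_set_obs_pmf [simp]: "finite (set_pmf (obs_pmf n d M))"
proof (rule finite_subset)
  show "set_pmf (obs_pmf n d M) \<subseteq> PiE_dflt (idx n d) 0 (set_pmf \<circ> (\<lambda>ik. sign_pmf (M ik)))"
    unfolding obs_pmf_def by (rule set_Pi_pmf_subset') simp
qed (auto simp: sign_pmf_def)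

lemma obs_pmf_sign:
  assumes "Y \<in> set_pmf (obs_pmf n d M)" "ik \<in> idx n d"
  shows "Y ik \<in> {-1, 1}"
proof -
  have "Y \<in> PiE_dflt (idx n d) 0 (set_pmf \<circ> (\<lambda>ik. sign_pmf (M ik)))"
    using assms(1) subsetD[OF set_Pi_pmf_subset'[OF finite_idx]] unfolding obs_pmf_def by metis
  then have "Y ik \<in> set_pmf (sign_pmf (M ik))"
    using assms(2) by (cases ik) (simp add: PiE_dflt_def)
  then show ?thesis
    by (auto simp: sign_pmf_def)
qed

lemma EM_cong:
  assumes "\<And>Y. (\<And>ik. ik \<in> idx n d \<Longrightarrow> Y ik \<in> {-1, 1}) \<Longrightarrow> f Y = g Y"
  shows "EM n d M f = EM n d M g"
  unfolding EM_def
  by (rule integral_cong_AE) (auto simp: AE_measure_pmf_iff intro!: assms dest: obs_pmf_sign)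

lemma EM_sum:
  assumes "finite I"
  shows "EM n d M (\<lambda>Y. \<Sum>i\<in>I. c i * g i Y) = (\<Sum>i\<in>I. c i * EM n d M (g i))"
  unfolding EM_def
  by (subst Bochner_Integration.integral_sum) (auto intro!: integrable_measure_pmf_finite)

text \<open>
  The Walsh characters of the group of sign matrices.
\<close>

definition chi :: "(nat \<times> nat) set \<Rightarrow> rmatrix \<Rightarrow> real" where
  "chi G Y = (\<Prod>ik\<in>G. Y ik)"

lemma EM_chi:
  assumes G: "G \<subseteq> idx n d" and M: "\<And>ik. ik \<in> G \<Longrightarrow> \<bar>M ik\<bar> \<le> 1"
  shows "EM n d M (chi G) = (\<Prod>ik\<in>G. M ik)"
proof -
  let ?p = "measure_pmf (obs_pmf n d M)"
  have "prob_space.indep_vars ?p (\<lambda>_. count_space UNIV) (\<lambda>ik Y. Y ik) (idx n d)"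
    unfolding obs_pmf_def by (rule indep_vars_Pi_pmf) simp
  then have "prob_space.indep_vars ?p (\<lambda>_. count_space UNIV) (\<lambda>ik Y. Y ik) G"
    using G by (rule prob_space.indep_vars_subset[OF prob_space_measure_pmf])
  then have "prob_space.indep_vars ?p (\<lambda>_. borel) (\<lambda>ik Y. Y ik) G"
    by (rule prob_space.indep_vars_compose2[OF prob_space_measure_pmf]) auto
  then have "EM n d M (chi G) = (\<Prod>ik\<in>G. integral\<^sup>L ?p (\<lambda>Y. Y ik))"
    unfolding EM_def chi_def
    by (intro prob_space.indep_vars_lebesgue_integral[OF prob_space_measure_pmf])
      (auto intro: finite_subset[OF G] integrable_measure_pmf_finite)
  also have "\<dots> = (\<Prod>ik\<in>G. M ik)"
  proof (rule prod.cong[OF refl])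
    fix ik assume ik: "ik \<in> G"
    have "integral\<^sup>L ?p (\<lambda>Y. Y ik) = measure_pmf.expectation (map_pmf (\<lambda>Y. Y ik) (obs_pmf n d M)) (\<lambda>y. y)"
      by simp
    also have "map_pmf (\<lambda>Y. Y ik) (obs_pmf n d M) = sign_pmf (M ik)"
      using ik G by (auto simp: obs_pmf_def Pi_pmf_component)
    finally show "integral\<^sup>L ?p (\<lambda>Y. Y ik) = M ik"
      using M[OF ik] by (simp add: expectation_sign_pmf)
  qed
  finally show ?thesis .
qed

text \<open>
  The entries shared by \<open>G\<close> and \<open>H\<close> appear squared and drop out, leaving the character of the
  symmetric difference. This gives the orthonormality under pure noise, where every nonempty
  character has mean zero.
\<close>

lemma chi_mult_chi:
  assumes "finite G" "finite H" "\<And>ik. ik \<in> G \<union> H \<Longrightarrow> Y ik \<in> {-1, 1}"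
  shows "chi G Y * chi H Y = chi ((G - H) \<union> (H - G)) Y"
proof -
  have sq: "(\<Prod>ik\<in>G \<inter> H. Y ik) * (\<Prod>ik\<in>G \<inter> H. Y ik) = 1"
    unfolding prod.distrib[symmetric] using assms(3) by (intro prod.neutral) force
  have G: "chi G Y = (\<Prod>ik\<in>G - H. Y ik) * (\<Prod>ik\<in>G \<inter> H. Y ik)"
    unfolding chi_def using assms prod.Int_Diff[of G Y H] by (simp add: mult.commute)
  have H: "chi H Y = (\<Prod>ik\<in>H - G. Y ik) * (\<Prod>ik\<in>G \<inter> H. Y ik)"
    unfolding chi_def using assms prod.Int_Diff[of H Y G] by (simp add: mult.commute Int_commute)
  have "chi G Y * chi H Y = (\<Prod>ik\<in>G - H. Y ik) * (\<Prod>ik\<in>H - G. Y ik)"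
    unfolding G H using sq by (metis (no_types, lifting) mult.assoc mult.left_commute mult.right_neutral)
  also have "\<dots> = chi ((G - H) \<union> (H - G)) Y"
    unfolding chi_def using assms by (intro prod.union_disjoint[symmetric]) auto
  finally show ?thesis .
qed

lemma EM_M0_chi_mult_chi:
  assumes "G \<subseteq> idx n d" "H \<subseteq> idx n d"
  shows "EM n d M0 (\<lambda>Y. chi G Y * chi H Y) = of_bool (G = H)"
proof -
  have "EM n d M0 (\<lambda>Y. chi G Y * chi H Y) = EM n d M0 (chi ((G - H) \<union> (H - G)))"
    using assms finite_subset[OF _ finite_idx]
    by (intro EM_cong chi_mult_chi) blast+
  also have "\<dots> = (\<Prod>ik\<in>(G - H) \<union> (H - G). 0)"
    using assms by (subst EM_chi) (auto simp: M0_def)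
  also have "\<dots> = of_bool (G = H)"
  proof (cases "G = H")
    case False
    moreover have "finite ((G - H) \<union> (H - G))"
      using assms finite_subset[OF _ finite_idx] by blast
    ultimately show ?thesis by (subst prod_zero) auto
  qed simp
  finally show ?thesis .
qed

lemma EM_M0_square:
  assumes "\<And>Y. (\<And>ik. ik \<in> idx n d \<Longrightarrow> Y ik \<in> {-1, 1}) \<Longrightarrow> f Y = (\<Sum>G\<in>low_sets n d D. c G * chi G Y)"
  shows "EM n d M0 (\<lambda>Y. (f Y)\<^sup>2) = (\<Sum>G\<in>low_sets n d D. (c G)\<^sup>2)"
proof -
  let ?L = "low_sets n d D"
  have "EM n d M0 (\<lambda>Y. (f Y)\<^sup>2)
      = EM n d M0 (\<lambda>Y. \<Sum>p\<in>?L \<times> ?L. (c (fst p) * c (snd p)) * (chi (fst p) Y * chi (snd p) Y))"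
    by (rule EM_cong)
      (simp add: assms power2_eq_square sum_product sum.cartesian_product case_prod_unfold mult_ac)
  also have "\<dots> = (\<Sum>p\<in>?L \<times> ?L. (c (fst p) * c (snd p)) * of_bool (fst p = snd p))"
    by (subst EM_sum) (simp, intro sum.cong refl, simp add: EM_M0_chi_mult_chi low_sets_def mem_Times_iff)
  also have "\<dots> = (\<Sum>G\<in>?L. \<Sum>H\<in>?L. if G = H then c G * c H else 0)"
    unfolding sum.cartesian_product
    by (rule sum.cong[OF refl]) (simp add: case_prod_unfold of_bool_def)
  also have "\<dots> = (\<Sum>G\<in>?L. (c G)\<^sup>2)"
    by (simp add: power2_eq_square)
  finally show ?thesis .
qed

lemma monomial_eq_chi_odd:
  assumes "\<And>ik. ik \<in> idx n d \<Longrightarrow> Y ik \<in> {-1, 1::real}"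
  shows "(\<Prod>ik\<in>idx n d. Y ik ^ \<alpha> ik) = chi {ik \<in> idx n d. odd (\<alpha> ik)} Y"
proof -
  have "(\<Prod>ik\<in>idx n d. Y ik ^ \<alpha> ik) = (\<Prod>ik\<in>idx n d. if odd (\<alpha> ik) then Y ik else 1)"
  proof (rule prod.cong[OF refl])
    fix ik assume "ik \<in> idx n d"
    from assms[OF this] show "Y ik ^ \<alpha> ik = (if odd (\<alpha> ik) then Y ik else 1)" by auto
  qed
  then show ?thesis
    unfolding chi_def by (simp add: prod.inter_filter)
qed

text \<open>
  For entries \<open>-1\<close> and \<open>1\<close> only the parity of each exponent matters. Dropping even powers can only
  lower the degree, so the monomials collapse to characters of at most \<open>D\<close> entries.
\<close>

lemma polys_le_Fourier:
  assumes "f \<in> polys_le n d D"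
  obtains c where "\<And>Y. (\<And>ik. ik \<in> idx n d \<Longrightarrow> Y ik \<in> {-1, 1}) \<Longrightarrow>
                     f Y = (\<Sum>G\<in>low_sets n d D. c G * chi G Y)"
proof -
  obtain A :: "(nat \<times> nat \<Rightarrow> nat) set" and a where A: "finite A"
    and deg: "\<And>\<alpha>. \<alpha> \<in> A \<Longrightarrow> (\<Sum>ik\<in>idx n d. \<alpha> ik) \<le> D"
    and f: "f = (\<lambda>Y. \<Sum>\<alpha>\<in>A. a \<alpha> * (\<Prod>ik\<in>idx n d. Y ik ^ \<alpha> ik))"
    using assms unfolding polys_le_def by blast
  \<comment> \<open>Coefficients of monomials with the same parities are added up.\<close>
  define odds where "odds \<alpha> = {ik \<in> idx n d. odd (\<alpha> ik)}" for \<alpha> :: "nat \<times> nat \<Rightarrow> nat"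
  have low: "odds ` A \<subseteq> low_sets n d D"
  proof
    fix G assume "G \<in> odds ` A"
    then obtain \<alpha> where \<alpha>: "\<alpha> \<in> A" "G = odds \<alpha>" by blast
    have "card (odds \<alpha>) = (\<Sum>ik\<in>odds \<alpha>. 1)" by simp
    also have "\<dots> \<le> (\<Sum>ik\<in>odds \<alpha>. \<alpha> ik)"
      by (rule sum_mono) (auto simp: odds_def elim: oddE)
    also have "\<dots> \<le> (\<Sum>ik\<in>idx n d. \<alpha> ik)"
      by (rule sum_mono2) (auto simp: odds_def)
    also have "\<dots> \<le> D" using deg \<alpha> by blast
    finally show "G \<in> low_sets n d D" using \<alpha> by (auto simp: low_sets_def odds_def)
  qed
  show thesis
  proof (rule that)
    fix Y :: rmatrix assume Y: "\<And>ik. ik \<in> idx n d \<Longrightarrow> Y ik \<in> {-1, 1}"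
    have "f Y = (\<Sum>\<alpha>\<in>A. a \<alpha> * chi (odds \<alpha>) Y)"
      using Y by (simp add: f odds_def monomial_eq_chi_odd)
    also have "\<dots> = (\<Sum>G\<in>low_sets n d D. \<Sum>\<alpha> | \<alpha> \<in> A \<and> odds \<alpha> = G. a \<alpha> * chi (odds \<alpha>) Y)"
      by (rule sum.group[symmetric, OF A finite_low_sets low])
    also have "\<dots> = (\<Sum>G\<in>low_sets n d D. (\<Sum>\<alpha> | \<alpha> \<in> A \<and> odds \<alpha> = G. a \<alpha>) * chi G Y)"
      unfolding sum_distrib_right by (intro sum.cong) auto
    finally show "f Y = \<dots>" .
  qed
qed

section \<open>The planted mixture\<close>

definition plant :: "real \<Rightarrow> nat set \<times> nat set \<Rightarrow> rmatrix" where
  "plant l x = (\<lambda>ik. l * indicator (cells x) ik)"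

lemma planted_eq: "planted n d l Kn Kd = plant l ` supports n d Kn Kd"
proof -
  have "plant l ` supports n d Kn Kd
          = {M. \<exists>S T. S \<in> ksubsets {1..n} Kn \<and> T \<in> ksubsets {1..d} Kd \<and> M = plant l (S, T)}"
    unfolding supports_def by blast
  then show ?thesis
    by (simp add: planted_def plant_def cells_def ksubsets_def conj_assoc)
qed

text \<open>
  The uniform law on planted matrices agrees with the uniform law on pairs of supports because a
  nonempty rectangle determines its sides.
\<close>

lemma inj_on_plant:
  assumes "l \<noteq> 0" "0 < Kn" "0 < Kd"
  shows "inj_on (plant l) (supports n d Kn Kd)"
proof (rule inj_onI)
  fix x y assume xy: "x \<in> supports n d Kn Kd" "y \<in> supports n d Kn Kd" "plant l x = plant l y"
  have "cells x = cells y"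
  proof (rule set_eqI)
    fix ik
    show "ik \<in> cells x \<longleftrightarrow> ik \<in> cells y"
      using fun_cong[OF xy(3), of ik] assms(1) by (auto simp: plant_def indicator_def split: if_splits)
  qed
  moreover have "fst x \<noteq> {}" "snd x \<noteq> {}"
    using xy(1) assms by (auto simp: supports_def ksubsets_def)
  ultimately show "x = y"
    by (auto simp: cells_def times_eq_iff prod_eq_iff)
qed

lemma card_supports_pos:
  assumes "Kn \<le> n" "Kd \<le> d"
  shows "0 < card (supports n d Kn Kd)"
  using assms by (simp add: supports_def card_cartesian_product card_ksubsets)

lemma Emu_eq:
  assumes "l \<noteq> 0" "Kn \<in> {1..n}" "Kd \<in> {1..d}"
  shows "Emu n d l Kn Kd g
           = (\<Sum>x\<in>supports n d Kn Kd. EM n d (plant l x) g) / real (card (supports n d Kn Kd))"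
proof -
  have inj: "inj_on (plant l) (supports n d Kn Kd)"
    using assms by (intro inj_on_plant) auto
  have "supports n d Kn Kd \<noteq> {}"
    using card_supports_pos[of Kn n Kd d] assms by (metis atLeastAtMost_iff card.empty less_irrefl)
  then have "Emu n d l Kn Kd g
      = (\<Sum>M\<in>planted n d l Kn Kd. EM n d M g /\<^sub>R real (card (planted n d l Kn Kd)))"
    unfolding Emu_def EM_def by (intro pmf_expectation_bind_pmf_of_set) (auto simp: planted_eq)
  then show ?thesis
    unfolding planted_eq using inj
    by (simp add: sum.reindex card_image sum_distrib_left divide_inverse mult.commute)
qed

lemma Emu_chi:
  assumes "0 < l" "l < 1" "Kn \<in> {1..n}" "Kd \<in> {1..d}" "G \<subseteq> idx n d"
  shows "Emu n d l Kn Kd (chi G)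
           = (\<Sum>x\<in>supports n d Kn Kd. if G \<subseteq> cells x then l ^ card G else 0)
             / real (card (supports n d Kn Kd))"
proof -
  have "EM n d (plant l x) (chi G) = (if G \<subseteq> cells x then l ^ card G else 0)" for x
  proof -
    have "EM n d (plant l x) (chi G) = (\<Prod>ik\<in>G. l * indicator (cells x) ik)"
      using assms by (subst EM_chi) (auto simp: plant_def indicator_def)
    also have "\<dots> = (if G \<subseteq> cells x then l ^ card G else 0)"
    proof (cases "G \<subseteq> cells x")
      case True
      then have "(\<Prod>ik\<in>G. l * indicator (cells x) ik) = (\<Prod>ik\<in>G. l)"
        by (intro prod.cong) (auto simp: indicator_def)
      with True show ?thesis by simp
    next
      case False
      then show ?thesis
        using finite_subset[OF assms(5) finite_idx] by (auto simp: indicator_def intro!: prod_zero)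
    qed
    finally show ?thesis .
  qed
  then show ?thesis using assms by (subst Emu_eq) auto
qed

text \<open>
  Cauchy-Schwarz against the character coefficients of \<open>f\<close>, whose squares sum to the second moment
  of \<open>f\<close> under pure noise.
\<close>

lemma Emu_square_le:
  assumes "0 < l" "l < 1" "Kn \<in> {1..n}" "Kd \<in> {1..d}" "f \<in> polys_le n d D"
  shows "(Emu n d l Kn Kd f)\<^sup>2
           \<le> EM n d M0 (\<lambda>Y. (f Y)\<^sup>2) * (\<Sum>G\<in>low_sets n d D. (Emu n d l Kn Kd (chi G))\<^sup>2)"
proof -
  obtain c where c: "\<And>Y. (\<And>ik. ik \<in> idx n d \<Longrightarrow> Y ik \<in> {-1, 1}) \<Longrightarrow>
                     f Y = (\<Sum>G\<in>low_sets n d D. c G * chi G Y)"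
    using polys_le_Fourier[OF assms(5)] by blast
  have second_moment: "EM n d M0 (\<lambda>Y. (f Y)\<^sup>2) = (\<Sum>G\<in>low_sets n d D. (c G)\<^sup>2)"
    by (rule EM_M0_square) (rule c)
  have "EM n d M f = (\<Sum>G\<in>low_sets n d D. c G * EM n d M (chi G))" for M
    using EM_cong[of n d f _ M, OF c] by (simp add: EM_sum)
  then have "Emu n d l Kn Kd f
      = (\<Sum>x\<in>supports n d Kn Kd. \<Sum>G\<in>low_sets n d D. c G * EM n d (plant l x) (chi G))
        / real (card (supports n d Kn Kd))"
    using assms by (simp add: Emu_eq)
  also have "\<dots> = (\<Sum>G\<in>low_sets n d D. \<Sum>x\<in>supports n d Kn Kd. c G * EM n d (plant l x) (chi G))
        / real (card (supports n d Kn Kd))"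
    by (subst sum.swap) (rule refl)
  also have "\<dots> = (\<Sum>G\<in>low_sets n d D. c G * Emu n d l Kn Kd (chi G))"
    using assms by (simp add: Emu_eq sum_divide_distrib[of _ "low_sets n d D"] flip: sum_distrib_left)
  finally have "Emu n d l Kn Kd f = (\<Sum>G\<in>low_sets n d D. c G * Emu n d l Kn Kd (chi G))" .
  then show ?thesis
    using Cauchy_Schwarz_ineq_sum[of c "\<lambda>G. Emu n d l Kn Kd (chi G)" "low_sets n d D"]
    by (simp only: second_moment)
qed

text \<open>
  Nonnegativity of the variance of \<open>f - 1\<close> under the mixture.
\<close>

lemma Emu_shifted_square_ge:
  "(Emu n d l Kn Kd f - 1)\<^sup>2 \<le> Emu n d l Kn Kd (\<lambda>Y. (f Y - 1)\<^sup>2)"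
  if "l \<noteq> 0" "Kn \<in> {1..n}" "Kd \<in> {1..d}"
proof -
  let ?p = "bind_pmf (pmf_of_set (planted n d l Kn Kd)) (obs_pmf n d)"
  have "supports n d Kn Kd \<noteq> {}"
    using card_supports_pos[of Kn n Kd d] that by (metis atLeastAtMost_iff card.empty less_irrefl)
  then have "finite (set_pmf ?p)"
    by (auto simp: planted_eq)
  then have int: "integrable (measure_pmf ?p) h" for h :: "rmatrix \<Rightarrow> real"
    by (rule integrable_measure_pmf_finite)
  have "0 \<le> measure_pmf.variance ?p (\<lambda>Y. f Y - 1)"
    by (rule measure_pmf.variance_positive)
  then have "(measure_pmf.expectation ?p (\<lambda>Y. f Y - 1))\<^sup>2 \<le> measure_pmf.expectation ?p (\<lambda>Y. (f Y - 1)\<^sup>2)"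
    by (subst (asm) measure_pmf.variance_eq) (auto intro: int)
  then show ?thesis
    unfolding Emu_def by (subst (asm) Bochner_Integration.integral_diff) (auto intro: int)
qed

section \<open>From the advantage to the risk\<close>

text \<open>
  A small noise risk caps the planted mean of \<open>f\<close>: if \<open>E[f\<^sup>2] < (1 - \<delta>) / 4\<close>, its square is at most
  \<open>(1 - \<delta>) * (1 + \<delta>) / 4 \<le> (1 / 2)\<^sup>2\<close>. By Jensen, the average over planted matrices of the risk
  for the target \<open>1\<close> is then at least \<open>(1 / 2)\<^sup>2\<close>, and some planted matrix has at least the average risk.
\<close>

lemma testing_risk_ge:
  assumes "l \<noteq> 0" "Kn \<in> {1..n}" "Kd \<in> {1..d}"
    and \<delta>: "0 \<le> \<delta>"
    and adv: "(Emu n d l Kn Kd f)\<^sup>2 \<le> EM n d M0 (\<lambda>Y. (f Y)\<^sup>2) * (1 + \<delta>)"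
  shows "\<exists>M\<in>planted n d l Kn Kd \<union> {M0}. (1 - \<delta>) / 4 \<le> EM n d M (\<lambda>Y. (f Y - x0 M)\<^sup>2)"
proof (cases "(1 - \<delta>) / 4 \<le> EM n d M0 (\<lambda>Y. (f Y)\<^sup>2)")
  case True
  then show ?thesis by (intro bexI[of _ M0]) (auto simp: x0_def)
next
  case False
  let ?P = "supports n d Kn Kd" and ?m = "Emu n d l Kn Kd f"
  let ?r = "Emu n d l Kn Kd (\<lambda>Y. (f Y - 1)\<^sup>2)"
  have "?m\<^sup>2 \<le> (1 - \<delta>) / 4 * (1 + \<delta>)"
    using adv False \<delta> by (smt (verit) mult_right_mono)
  also have "\<dots> \<le> (1 / 2)\<^sup>2"
    by (simp add: algebra_simps power2_eq_square)
  finally have "?m \<le> 1 / 2"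
    by (rule power2_le_imp_le) simp
  then have "(1 / 2)\<^sup>2 \<le> (1 - ?m)\<^sup>2"
    by (intro power_mono) auto
  also have "(1 - ?m)\<^sup>2 \<le> ?r"
    using Emu_shifted_square_ge[OF assms(1-3), of f] by (simp add: power2_commute)
  finally have r: "(1 - \<delta>) / 4 \<le> ?r" using \<delta> by (simp add: power2_eq_square)
  have pos: "0 < card ?P"
    using assms by (intro card_supports_pos) auto
  have "\<exists>x\<in>?P. ?r \<le> EM n d (plant l x) (\<lambda>Y. (f Y - 1)\<^sup>2)"
  proof (rule ccontr)
    assume "\<not> ?thesis"
    then have "(\<Sum>x\<in>?P. EM n d (plant l x) (\<lambda>Y. (f Y - 1)\<^sup>2)) < (\<Sum>x\<in>?P. ?r)"
      using pos by (intro sum_strict_mono) (auto simp: card_gt_0_iff)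
    then show False
      using pos Emu_eq[OF assms(1-3), of "\<lambda>Y. (f Y - 1)\<^sup>2"]
      by (simp add: field_simps split: if_splits)
  qed
  then obtain x where x: "x \<in> ?P" "?r \<le> EM n d (plant l x) (\<lambda>Y. (f Y - 1)\<^sup>2)" by blast
  have "cells x \<noteq> {}"
    using x(1) assms by (auto simp: supports_def ksubsets_def cells_def)
  then obtain ik where "ik \<in> cells x" by blast
  then have "plant l x ik \<noteq> M0 ik" using assms(1) by (simp add: plant_def M0_def)
  then have "x0 (plant l x) = 1" by (auto simp: x0_def)
  then show ?thesis using x r by (intro bexI[of _ "plant l x"]) (auto simp: planted_eq)
qed

lemma const_in_polys_le: "(\<lambda>Y. 1) \<in> polys_le n d D"
  unfolding polys_le_def
  by (intro CollectI exI[of _ "{\<lambda>_. 0}"] exI[of _ "\<lambda>_. 1"]) simp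

lemma Adv_one: "Adv n d l Kn Kd (\<lambda>_. 1) = 1"
  by (simp add: Adv_def Emu_def EM_def)

text \<open>
  Squaring the supremum needs its sign: the constant polynomial \<open>1\<close> has advantage \<open>1\<close>, so the
  supremum is nonnegative. When the noise second moment of \<open>f\<close> vanishes, the hypothesis makes the
  planted mean vanish too, so the convention \<open>0/0 = 1\<close> applies and \<open>1 \<le> B\<close> covers that case.
\<close>

lemma Adv_le_square_le:
  assumes B: "1 \<le> B"
    and adv: "\<And>f. f \<in> polys_le n d D \<Longrightarrow> (Emu n d l Kn Kd f)\<^sup>2 \<le> EM n d M0 (\<lambda>Y. (f Y)\<^sup>2) * B"
  shows "(Adv_le n d l Kn Kd D)\<^sup>2 \<le> ereal B"
proof -
  have "Adv n d l Kn Kd f \<le> sqrt B" if f: "f \<in> polys_le n d D" for f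
  proof (cases "EM n d M0 (\<lambda>Y. (f Y)\<^sup>2) = 0")
    case True
    then show ?thesis using adv[OF f] B by (simp add: Adv_def)
  next
    case False
    let ?v = "EM n d M0 (\<lambda>Y. (f Y)\<^sup>2)"
    have v: "0 < ?v" using False by (simp add: EM_def order_less_le)
    have "Emu n d l Kn Kd f \<le> sqrt (?v * B)"
      by (rule real_le_rsqrt[OF adv[OF f]])
    then show ?thesis using v by (simp add: Adv_def real_sqrt_mult field_simps)
  qed
  then have le: "Adv_le n d l Kn Kd D \<le> ereal (sqrt B)"
    unfolding Adv_le_def by (intro SUP_least) simp
  have "ereal (Adv n d l Kn Kd (\<lambda>_. 1)) \<le> Adv_le n d l Kn Kd D"
    unfolding Adv_le_def by (rule SUP_upper[OF const_in_polys_le])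
  then have "0 \<le> Adv_le n d l Kn Kd D"
    by (simp add: Adv_one order_trans[rotated])
  then have "(Adv_le n d l Kn Kd D)\<^sup>2 \<le> (ereal (sqrt B))\<^sup>2"
    unfolding power2_eq_square using le B by (intro ereal_mult_mono) auto
  also have "\<dots> = ereal B" using B by simp
  finally show ?thesis .
qed

lemma exp_5_le: "exp 5 \<le> (243 :: real)"
proof -
  have "exp 5 = exp (1::real) ^ 5" by (simp flip: exp_of_nat_mult)
  also have "\<dots> \<le> 3 ^ 5" by (intro power_mono exp_le) simp
  finally show ?thesis by simp
qed

theorem theorem3p1:
  fixes n d Kn Kd D :: nat and l c :: real
  assumes "n \<ge> 1" and "d \<ge> 1"
    and "0 < l" and "l < 1"
    and "Kn \<in> {1..n}" and "Kd \<in> {1..d}"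
    and "0 < D" and "D \<le> n * d"
    and "c \<ge> 10"
    and "Max {l * sqrt (real (min D (min Kn Kd))),
              l * (real Kd / sqrt (real d)),
              l * (real Kn / sqrt (real n)),
              l * (real (Kn * Kd) / sqrt (real (n * d)))}
         \<le> 2 powr (- 2 - c)"
  shows "(Adv_le n d l Kn Kd D)\<^sup>2 \<le> ereal (1 + 2 powr (- c)) \<and>
         (INF f \<in> polys_le n d D. SUP M \<in> planted n d l Kn Kd \<union> {M0}.
            ereal (EM n d M (\<lambda>Y. (f Y - x0 M)\<^sup>2)))
         \<ge> ereal (1 / 4 * (1 - 2 powr (- c)))"
proof -
  define \<eta> :: real where "\<eta> = 2 powr (- 2 - c)"
  define \<delta> :: real where "\<delta> = 2 powr (- c)"
  have \<delta>: "\<delta> = 4 * \<eta>" "0 < \<eta>"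
    by (simp_all add: \<delta>_def \<eta>_def powr_diff powr_minus_divide)
  have \<eta>_le: "\<eta> \<le> 1 / 4096"
  proof -
    have "\<eta> \<le> 2 powr (- 12)" unfolding \<eta>_def using assms(9) by (intro powr_mono) auto
    also have "\<dots> = 1 / 4096" by (simp add: powr_minus powr_numeral)
    finally show ?thesis .
  qed
  have bounds: "l * sqrt (real (min D (min Kn Kd))) \<le> \<eta>" "l * (real Kd / sqrt (real d)) \<le> \<eta>"
    "l * (real Kn / sqrt (real n)) \<le> \<eta>" "l * (real (Kn * Kd) / sqrt (real (n * d))) \<le> \<eta>"
    using assms(10) by (auto simp: \<eta>_def)
  have square: "l\<^sup>2 * x\<^sup>2 \<le> \<eta>\<^sup>2" if "l * x \<le> \<eta>" "0 \<le> x" for x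
    using power_mono[OF that(1), of 2] that(2) assms(3) by (simp add: power_mult_distrib)
  have W: "(\<Sum>G\<in>low_sets n d D. (\<Sum>x\<in>supports n d Kn Kd. if G \<subseteq> cells x then l ^ card G else 0)\<^sup>2)
           \<le> (1 + 2 * (exp 5 * \<eta>\<^sup>2)) * (real (card (supports n d Kn Kd)))\<^sup>2"
  proof (rule low_degree_norm_le[OF assms(5,6)])
    show "l\<^sup>2 * real (min D (min Kn Kd)) \<le> \<eta>\<^sup>2" using square[OF bounds(1)] by simp
    show "l\<^sup>2 * ((real Kd)\<^sup>2 / real d) \<le> \<eta>\<^sup>2" using square[OF bounds(2)] by (simp add: power_divide)
    show "l\<^sup>2 * ((real Kn)\<^sup>2 / real n) \<le> \<eta>\<^sup>2" using square[OF bounds(3)] by (simp add: power_divide)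
    show "l\<^sup>2 * ((real Kn)\<^sup>2 / real n * ((real Kd)\<^sup>2 / real d)) \<le> \<eta>\<^sup>2"
      using square[OF bounds(4)] by (simp add: power_divide power_mult_distrib)
    have "exp 5 * \<eta>\<^sup>2 \<le> 243 * (1 / 4096)\<^sup>2"
      using \<eta>_le \<delta> by (intro mult_mono power_mono exp_5_le) auto
    then show "exp 5 * \<eta>\<^sup>2 \<le> 1 / 2" by (simp add: power2_eq_square)
  qed
  have "exp 5 * \<eta>\<^sup>2 \<le> 243 * (1 / 4096 * \<eta>)"
    unfolding power2_eq_square using \<eta>_le \<delta> by (intro mult_mono exp_5_le) auto
  then have small: "2 * (exp 5 * \<eta>\<^sup>2) \<le> \<delta>" using \<delta> by linarith
  have pos: "0 < card (supports n d Kn Kd)"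
    using assms by (intro card_supports_pos) auto
  have "(\<Sum>G\<in>low_sets n d D. (Emu n d l Kn Kd (chi G))\<^sup>2)
      = (\<Sum>G\<in>low_sets n d D. (\<Sum>x\<in>supports n d Kn Kd. if G \<subseteq> cells x then l ^ card G else 0)\<^sup>2)
        / (real (card (supports n d Kn Kd)))\<^sup>2"
    unfolding sum_divide_distrib
    using assms by (intro sum.cong refl) (simp add: Emu_chi low_sets_def power_divide)
  also have "\<dots> \<le> 1 + 2 * (exp 5 * \<eta>\<^sup>2)"
  proof (subst pos_divide_le_eq)
    show "0 < (real (card (supports n d Kn Kd)))\<^sup>2"
      using pos by (intro zero_less_power) (simp only: of_nat_0_less_iff)
  qed (rule W)
  also have "\<dots> \<le> 1 + \<delta>" using small by simp
  finally have norm: "(\<Sum>G\<in>low_sets n d D. (Emu n d l Kn Kd (chi G))\<^sup>2) \<le> 1 + \<delta>" .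
  have adv: "(Emu n d l Kn Kd f)\<^sup>2 \<le> EM n d M0 (\<lambda>Y. (f Y)\<^sup>2) * (1 + \<delta>)" if "f \<in> polys_le n d D" for f
    using Emu_square_le[OF assms(3-6) that] norm
    by (rule order_trans[OF _ mult_left_mono]) (simp add: EM_def)
  have "(Adv_le n d l Kn Kd D)\<^sup>2 \<le> ereal (1 + \<delta>)"
    using \<delta> by (intro Adv_le_square_le adv) auto
  moreover have "ereal (1 / 4 * (1 - \<delta>))
      \<le> (INF f \<in> polys_le n d D. SUP M \<in> planted n d l Kn Kd \<union> {M0}.
            ereal (EM n d M (\<lambda>Y. (f Y - x0 M)\<^sup>2)))"
  proof (rule INF_greatest)
    fix f assume f: "f \<in> polys_le n d D"
    obtain M where M: "M \<in> planted n d l Kn Kd \<union> {M0}"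
      "(1 - \<delta>) / 4 \<le> EM n d M (\<lambda>Y. (f Y - x0 M)\<^sup>2)"
      using testing_risk_ge[OF _ assms(5,6) _ adv[OF f]] assms(3) \<delta> by auto
    show "ereal (1 / 4 * (1 - \<delta>))
      \<le> (SUP M \<in> planted n d l Kn Kd \<union> {M0}. ereal (EM n d M (\<lambda>Y. (f Y - x0 M)\<^sup>2)))"
      using M by (intro SUP_upper2[OF M(1)]) simp
  qed
  ultimately show ?thesis by (simp add: \<delta>_def)
qed

end
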